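(* Let $k,l_1,l_2,p$ be positive integers and let $m,n_1,n_2$ be nonnegative integers. Set $z_p^{-1}=0$. Then the following identities hold in $\mathfrak{h}^1$: \begin{align*} &z_k z_p^m \ast z_{l_1} z_p^{n_1} z_{l_2} z_p^{n_2}\\ =&\sum_{0\leqslant i_1\leqslant i_2\leqslant m}z_k(z_p^{i_1} z_{l_1}+z_p^{i_1-1}z_{p+l_1})\big[(z_p^{i_2-i_1}\ast z_p^{n_1})z_{l_2}+(z_p^{i_2-i_1-1}\ast z_p^{n_1})z_{p+l_2}\big](z_p^{m-i_2}\ast z_p^{n_2})\\ &+\sum_{\substack{0\leqslant i_1\leqslant n_1\\ 0\leqslant i_2\leqslant m}}z_{l_1}(z_p^{i_1} z_k+z_p^{i_1-1}z_{p+k})\big[(z_p^{i_2}\ast z_p^{n_1-i_1})z_{l_2}+(z_p^{i_2-1}\ast z_p^{n_1-i_1})z_{p+l_2}\big](z_p^{m-i_2}\ast z_p^{n_2})\\ &+z_{l_1}z_p^{n_1}z_{k+l_2}(z_{p}^m\ast z_p^{n_2})+\sum_{0\leqslant i\leqslant n_2}z_{l_1}z_p^{n_1}z_{l_2}(z_p^{i} z_k+z_p^{i-1}z_{p+k})(z_p^m\ast z_p^{n_2-i})\\ &+\sum_{0\leqslant i\leqslant m}z_{k+l_1}\big[(z_p^{i}\ast z_p^{n_1})z_{l_2}+(z_p^{i-1}\ast z_p^{n_1})z_{p+l_2}\big](z_p^{m-i}\ast z_p^{n_2}) \end{align*} and \begin{align*} &z_k z_p^m \,\bar{\ast}\, z_{l_1}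 z_p^{n_1} z_{l_2} z_p^{n_2}\\ =&\sum_{0\leqslant i_1\leqslant i_2\leqslant m}z_k(z_p^{i_1} z_{l_1}-z_p^{i_1-1}z_{p+l_1})\big[(z_p^{i_2-i_1}\,\bar{\ast}\, z_p^{n_1})z_{l_2}-(z_p^{i_2-i_1-1}\,\bar{\ast}\, z_p^{n_1})z_{p+l_2}\big](z_p^{m-i_2}\,\bar{\ast}\, z_p^{n_2})\\ &+\sum_{\substack{0\leqslant i_1\leqslant n_1\\ 0\leqslant i_2\leqslant m}}z_{l_1}(z_p^{i_1} z_k-z_p^{i_1-1}z_{p+k})\big[(z_p^{i_2}\,\bar{\ast}\, z_p^{n_1-i_1})z_{l_2}-(z_p^{i_2-1}\,\bar{\ast}\, z_p^{n_1-i_1})z_{p+l_2}\big](z_p^{m-i_2}\,\bar{\ast}\, z_p^{n_2})\\ &-z_{l_1}z_p^{n_1}z_{k+l_2}(z_{p}^m\,\bar{\ast}\, z_p^{n_2})+\sum_{0\leqslant i\leqslant n_2}z_{l_1}z_p^{n_1}z_{l_2}(z_p^{i} z_k-z_p^{i-1}z_{p+k})(z_p^m\,\bar{\ast}\, z_p^{n_2-i})\\ &-\sum_{0\leqslant i\leqslant m}z_{k+l_1}\big[(z_p^{i}\,\bar{\ast}\, z_p^{n_1})z_{l_2}-(z_p^{i-1}\,\bar{\ast}\, z_p^{n_1})z_{p+l_2}\big](z_p^{m-i}\,\bar{\ast}\, z_p^{n_2}). \end{align*}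
   Context: Let $Y=\{z_k\mid k=1,2,\ldots\}$ be an alphabet of noncommuting letters, $Y^{\ast}$ the set of all words in the letters of $Y$ (including the empty word $1$), and $\mathfrak{h}^1=\mathbb{Q}\langle Y\rangle$ the noncommutative polynomial algebra over $\mathbb{Q}$ generated by $Y$; it has $Y^{\ast}$ as a $\mathbb{Q}$-basis, and juxtaposition denotes the concatenation product, so for $m\geqslant 0$, $z_p^m$ is the word $z_p\cdots z_p$ with $m$ letters ($z_p^0=1$). The two stuffle products $\ast$ and $\bar{\ast}$ are the $\mathbb{Q}$-bilinear products on $\mathfrak{h}^1$ defined recursively by $$1\ast w=w\ast 1=w,\qquad z_kw_1\ast z_lw_2=z_k(w_1\ast z_lw_2)+z_l(z_kw_1\ast w_2)+z_{k+l}(w_1\ast w_2),$$ $$1\,\bar{\ast}\, w=w\,\bar{\ast}\, 1=w,\qquad z_kw_1\,\bar{\ast}\, z_lw_2=z_k(w_1\,\bar{\ast}\, z_lw_2)+z_l(z_kw_1\,\bar{\ast}\, w_2)-z_{k+l}(w_1\,\bar{\ast}\, w_2),$$ for all words $w,w_1,w_2\in Y^{\ast}$ and positive integers $k,l$. Both products are commutative and associative. The symbol $z_p^{-1}$ denotes the zero element of $\mathfrak{h}^1$ (not an inverse). *)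

theory Defs
  imports Complex_Main "HOL-Library.Poly_Mapping"
begin

text \<open>
  The alphabet \<open>Y\<close> consists of letters indexed by the positive integers. Words are wrapped in
  a datatype so that they can carry the additive monoid structure required by
  \<^theory>\<open>HOL-Library.Poly_Mapping\<close>: \<open>+\<close> on words is concatenation and \<open>0\<close> is the empty word.
  The type \<open>h1\<close> is then the monoid algebra of \<open>Y\<^sup>*\<close> over the rationals, and its ring
  multiplication \<open>*\<close> is the concatenation product.
\<close>

typedef letter = "{k::nat. 0 < k}"
  morphisms index letter_of
  by auto

datatype yword = Word (letters: "letter list")

instantiation yword :: monoid_add
begin

definition zero_yword :: yword where
  "zero_yword = Word []"

definition plus_yword :: "yword \<Rightarrow> yword \<Rightarrow> yword" where
  "plus_yword u v = Word (letters u @ letters v)"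

instance
  by standard (simp_all add: zero_yword_def plus_yword_def)

end

type_synonym h1 = "yword \<Rightarrow>\<^sub>0 rat"

definition word :: "letter list \<Rightarrow> h1" where
  "word w = Poly_Mapping.single (Word w) 1"

text \<open>Meaningful for \<open>k > 0\<close> only, since there is no letter of index \<open>0\<close>.\<close>

definition z :: "nat \<Rightarrow> h1" where
  "z k = word [letter_of k]"

text \<open>
  Only for exponents that may be \<open>-1\<close>, where \<open>z\<^sub>p\<close> to the power \<open>-1\<close> stands for the zero
  element; \<open>z p\<close> has no inverse in \<open>h1\<close>.
\<close>

definition zpow :: "nat \<Rightarrow> int \<Rightarrow> h1" where
  "zpow p e = (if e < 0 then 0 else z p ^ nat e)"

text \<open>
  Multiplication by \<open>single 0 c\<close> is multiplication by the scalar \<open>c\<close>.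
\<close>

definition bilinear_extension :: "(letter list \<Rightarrow> letter list \<Rightarrow> h1) \<Rightarrow> h1 \<Rightarrow> h1 \<Rightarrow> h1" where
  "bilinear_extension B f g =
     (\<Sum>u\<in>Poly_Mapping.keys f. \<Sum>v\<in>Poly_Mapping.keys g.
        Poly_Mapping.single 0 (Poly_Mapping.lookup f u * Poly_Mapping.lookup g v)
          * B (letters u) (letters v))"

fun stuffle_words :: "letter list \<Rightarrow> letter list \<Rightarrow> h1" where
  "stuffle_words [] w = word w"
| "stuffle_words w [] = word w"
| "stuffle_words (a # u) (b # v) =
     z (index a) * stuffle_words u (b # v)
     + z (index b) * stuffle_words (a # u) v
     + z (index a + index b) * stuffle_words u v"

fun stuffle_bar_words :: "letter list \<Rightarrow> letter list \<Rightarrow> h1" where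
  "stuffle_bar_words [] w = word w"
| "stuffle_bar_words w [] = word w"
| "stuffle_bar_words (a # u) (b # v) =
     z (index a) * stuffle_bar_words u (b # v)
     + z (index b) * stuffle_bar_words (a # u) v
     - z (index a + index b) * stuffle_bar_words u v"

definition stuffle :: "h1 \<Rightarrow> h1 \<Rightarrow> h1" (infixl \<open>\<star>\<close> 68) where
  "f \<star> g = bilinear_extension stuffle_words f g"

definition stuffle_bar :: "h1 \<Rightarrow> h1 \<Rightarrow> h1" (infixl \<open>\<star>\<^sub>-\<close> 68) where
  "f \<star>\<^sub>- g = bilinear_extension stuffle_bar_words f g"


lemma word_Nil: "word [] = 1"
  by (simp add: word_def zero_yword_def [symmetric])

lemma word_append: "word (u @ v) = word u * word v"
  by (simp add: word_def mult_single plus_yword_def)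

lemma word_Cons: "word (a # w) = z (index a) * word w"
  using word_append [of "[a]" w] by (simp add: z_def index_inverse)

lemma bilinear_extension_word: "bilinear_extension B (word u) (word v) = B u v"
  by (simp add: bilinear_extension_def word_def)

lemma bilinear_extension_supset:
  assumes "finite A" "Poly_Mapping.keys f \<subseteq> A" "finite C" "Poly_Mapping.keys g \<subseteq> C"
  shows "bilinear_extension B f g =
     (\<Sum>u\<in>A. \<Sum>v\<in>C.
        Poly_Mapping.single 0 (Poly_Mapping.lookup f u * Poly_Mapping.lookup g v)
          * B (letters u) (letters v))"
proof -
  have "bilinear_extension B f g = (\<Sum>u\<in>Poly_Mapping.keys f. \<Sum>v\<in>C.
        Poly_Mapping.single 0 (Poly_Mapping.lookup f u * Poly_Mapping.lookup g v)
          * B (letters u) (letters v))"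
    unfolding bilinear_extension_def using assms
    by (intro sum.cong refl sum.mono_neutral_left) (auto simp: in_keys_iff)
  also have "\<dots> = (\<Sum>u\<in>A. \<Sum>v\<in>C.
        Poly_Mapping.single 0 (Poly_Mapping.lookup f u * Poly_Mapping.lookup g v)
          * B (letters u) (letters v))"
    using assms by (intro sum.mono_neutral_left) (auto simp: in_keys_iff)
  finally show ?thesis .
qed

lemma bilinear_extension_add_left:
  "bilinear_extension B (f + f') g = bilinear_extension B f g + bilinear_extension B f' g"
  using Poly_Mapping.keys_add [of f f']
  by (simp add: bilinear_extension_supset
        [where A = "Poly_Mapping.keys f \<union> Poly_Mapping.keys f'" and C = "Poly_Mapping.keys g"]
      lookup_add single_add distrib_right sum.distrib)

lemma bilinear_extension_add_right:
  "bilinear_extension B f (g + g') = bilinear_extension B f g + bilinear_extension B f g'"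
  using Poly_Mapping.keys_add [of g g']
  by (simp add: bilinear_extension_supset
        [where A = "Poly_Mapping.keys f" and C = "Poly_Mapping.keys g \<union> Poly_Mapping.keys g'"]
      lookup_add single_add distrib_left distrib_right sum.distrib)

lemma lookup_scale: "Poly_Mapping.lookup (Poly_Mapping.single 0 c * f) w = c * Poly_Mapping.lookup f w"
  for f :: h1
  by (simp add: mult_map_scale_conv_mult [symmetric] Poly_Mapping.map.rep_eq when_def)

lemma keys_scale: "Poly_Mapping.keys (Poly_Mapping.single 0 c * f) \<subseteq> Poly_Mapping.keys f"
  for f :: h1
  by (auto simp: in_keys_iff lookup_scale)

lemma single_zero_mult: "Poly_Mapping.single 0 (c * d) = Poly_Mapping.single 0 c * (Poly_Mapping.single 0 d :: h1)"
  by (simp add: mult_single)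

lemma bilinear_extension_scale_left:
  "bilinear_extension B (Poly_Mapping.single 0 c * f) g = Poly_Mapping.single 0 c * bilinear_extension B f g"
  by (simp add: bilinear_extension_supset
        [where A = "Poly_Mapping.keys f" and C = "Poly_Mapping.keys g"]
      keys_scale lookup_scale single_zero_mult sum_distrib_left mult.assoc)

lemma bilinear_extension_scale_right:
  "bilinear_extension B f (Poly_Mapping.single 0 c * g) = Poly_Mapping.single 0 c * bilinear_extension B f g"
  by (simp add: bilinear_extension_supset
        [where A = "Poly_Mapping.keys f" and C = "Poly_Mapping.keys g"]
      keys_scale lookup_scale mult.left_commute [of _ c] single_zero_mult sum_distrib_left mult.assoc)

lemma stuffle_word_Nil: "1 \<star> word w = word w" "word w \<star> 1 = word w"
  by (cases w; simp add: stuffle_def bilinear_extension_word word_Nil [symmetric])+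

lemma stuffle_bar_word_Nil: "1 \<star>\<^sub>- word w = word w" "word w \<star>\<^sub>- 1 = word w"
  by (cases w; simp add: stuffle_bar_def bilinear_extension_word word_Nil [symmetric])+

lemma
  assumes "0 < k" "0 < l"
  shows stuffle_rec: "(z k * word u) \<star> (z l * word v) =
      z k * (word u \<star> (z l * word v)) + z l * ((z k * word u) \<star> word v) + z (k + l) * (word u \<star> word v)"
    and stuffle_bar_rec: "(z k * word u) \<star>\<^sub>- (z l * word v) =
      z k * (word u \<star>\<^sub>- (z l * word v)) + z l * ((z k * word u) \<star>\<^sub>- word v) - z (k + l) * (word u \<star>\<^sub>- word v)"
proof -
  have *: "z k * word w = word (letter_of k # w)" "z l * word w = word (letter_of l # w)"
      "index (letter_of k) = k" "index (letter_of l) = l" for w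
    using assms by (simp_all add: word_Cons letter_of_inverse)
  show "(z k * word u) \<star> (z l * word v) =
      z k * (word u \<star> (z l * word v)) + z l * ((z k * word u) \<star> word v) + z (k + l) * (word u \<star> word v)"
    unfolding *(1,2) stuffle_def bilinear_extension_word by (simp add: *(3,4))
  show "(z k * word u) \<star>\<^sub>- (z l * word v) =
      z k * (word u \<star>\<^sub>- (z l * word v)) + z l * ((z k * word u) \<star>\<^sub>- word v) - z (k + l) * (word u \<star>\<^sub>- word v)"
    unfolding *(1,2) stuffle_bar_def bilinear_extension_word by (simp add: *(3,4))
qed

end

theory Submission
  imports Defs
begin

text \<open>
  Both products obey the same recursion, except for the sign of the contracted letter
  \<open>z\<^sub>k\<^sub>+\<^sub>l\<close>. Hence both identities are instances of one identity for a product
  \<open>\<odot>\<close> whose contracted term carries a central weight \<open>c\<close>, taken at \<open>c = 1\<close> and \<open>c = -1\<close>.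

  A term of the product of two words is an interleaving of their letters in which a letter of one
  word may also be merged with a letter of the other. Fix a letter \<open>z\<^sub>l\<close> of the second word
  and sort the terms by what happens to it. Either it stands alone, and then the first word is cut
  into the part before it and the part after it; or it is merged with a letter of the first word,
  which again is cut there. If the first word is a power of \<open>z\<^sub>p\<close>, a cut is given by a
  number, which is \<open>power_split_at_letter\<close>. In the same way one can follow the first letter
  of a word through a leading power of \<open>z\<^sub>p\<close> in the other word, which is
  \<open>first_letter_through_power\<close>.

  To multiply \<open>z\<^sub>k z\<^sub>p\<^sup>m\<close> with \<open>z\<^sub>l\<^sub>1 z\<^sub>p\<^sup>n\<^sup>1 z\<^sub>l\<^sub>2 z\<^sub>p\<^sup>n\<^sup>2\<close>, the recursion asks which
  letter comes first. If it is \<open>z\<^sub>k\<close>, splitting at \<open>z\<^sub>l\<^sub>1\<close> and then at \<open>z\<^sub>l\<^sub>2\<close> gives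
  the sum over \<open>i\<^sub>1 \<le> i\<^sub>2\<close>. If it is the merged letter \<open>z\<^sub>k\<^sub>+\<^sub>l\<^sub>1\<close>, splitting at \<open>z\<^sub>l\<^sub>2\<close> gives the last
  sum. If it is \<open>z\<^sub>l\<^sub>1\<close>, the letter \<open>z\<^sub>k\<close> is followed through the rest of the second word: it
  lands in the first power of \<open>z\<^sub>p\<close> (and a split at \<open>z\<^sub>l\<^sub>2\<close> remains), or is merged with
  \<open>z\<^sub>l\<^sub>2\<close>, or lands in the second power of \<open>z\<^sub>p\<close>.
\<close>

section \<open>Words and index sets\<close>

definition words :: "h1 set" where
  "words = range word"

lemma one_in_words [simp]: "1 \<in> words"
  unfolding words_def by (metis word_Nil rangeI)

lemma z_in_words [simp]: "z k \<in> words"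
  by (simp add: words_def z_def)

lemma mult_in_words [simp]: "x \<in> words \<Longrightarrow> y \<in> words \<Longrightarrow> x * y \<in> words"
  unfolding words_def by (metis (no_types, lifting) imageE word_append rangeI)

lemma power_in_words [simp]: "x \<in> words \<Longrightarrow> x ^ n \<in> words"
  by (induction n) simp_all

lemma words_induct [consumes 1, case_names one mult]:
  assumes "x \<in> words" and "P 1"
    and step: "\<And>a x. 0 < a \<Longrightarrow> x \<in> words \<Longrightarrow> P x \<Longrightarrow> P (z a * x)"
  shows "P x"
proof -
  have "P (word u)" for u
  proof (induction u)
    case Nil
    then show ?case using \<open>P 1\<close> by (simp add: word_Nil)
  next
    case (Cons a u)
    then show ?case using step [of "index a" "word u"] index [of a]
      by (simp add: word_Cons words_def)
  qed
  then show ?thesis using \<open>x \<in> words\<close> by (auto simp: words_def)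
qed

lemma sum_triangle_shift:
  "(\<Sum>i\<le>m. \<Sum>j\<le>m - i. f i (i + j)) = (\<Sum>(i, j) \<in> {(i, j). i \<le> j \<and> j \<le> m}. f i j)"
  for f :: "nat \<Rightarrow> nat \<Rightarrow> 'a::comm_monoid_add"
  by (subst sum.Sigma, simp, simp)
     (rule sum.reindex_bij_witness [where j = "\<lambda>(i, j). (i, i + j)" and i = "\<lambda>(i, j). (i, j - i)"],
       auto)

section \<open>Stuffle products with a weighted contraction\<close>

text \<open>
  Vanishing at \<open>0\<close> is required because it makes the terms that contain \<open>z\<^sub>p\<close> to the power
  \<open>-1\<close> disappear; every other argument of the product in the expansion is a word.
\<close>

locale weighted_stuffle =
  fixes stf :: "h1 \<Rightarrow> h1 \<Rightarrow> h1" (infixl \<open>\<odot>\<close> 68) and c :: h1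
  assumes central: "f * c = c * f"
    and zero_left [simp]: "0 \<odot> f = 0"
    and one_left [simp]: "x \<in> words \<Longrightarrow> 1 \<odot> x = x"
    and one_right [simp]: "x \<in> words \<Longrightarrow> x \<odot> 1 = x"
    and rec: "0 < a \<Longrightarrow> 0 < b \<Longrightarrow> x \<in> words \<Longrightarrow> y \<in> words \<Longrightarrow>
      (z a * x) \<odot> (z b * y) =
        z a * (x \<odot> (z b * y)) + z b * ((z a * x) \<odot> y) + c * (z (a + b) * (x \<odot> y))"
begin

text \<open>
  For a letter on the left this is a terminating rewrite rule; for an arbitrary factor it would
  loop on \<open>c\<close> itself.
\<close>

lemma letter_central: "z a * (c * f) = c * (z a * f)"
  using central [of "z a"] by (simp add: mult.assoc [symmetric])

lemma zpow_one [simp]: "zpow p i \<odot> 1 = zpow p i"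
  by (simp add: zpow_def)

lemma zpow_nat [simp]: "zpow p (int i) = z p ^ i"
  by (simp add: zpow_def)

lemma zpow_0 [simp]: "zpow p 0 = 1"
  by (simp add: zpow_def)

lemma zpow_Suc [simp]: "zpow p (1 + int i) = z p ^ Suc i"
  by (simp add: zpow_def nat_add_distrib)

lemma zpow_minus_one [simp]: "zpow p (- 1) = 0"
  by (simp add: zpow_def)

text \<open>
  With the convention for the exponent \<open>-1\<close>, the recursion for a power of \<open>z\<^sub>p\<close> covers
  the exponent \<open>0\<close> as well. The two summands of each bracket in the expansion, whose
  exponents differ by one, can therefore be treated alike.
\<close>

lemma zpow_rec:
  assumes "0 < p" "0 < a" "x \<in> words"
  shows "zpow p (int i) \<odot> (z a * x) =
    z p * (zpow p (int i - 1) \<odot> (z a * x)) + z a * (zpow p (int i) \<odot> x)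
    + c * (z (p + a) * (zpow p (int i - 1) \<odot> x))"
  using assms by (cases i) (simp_all add: rec)

lemma zpow_Suc_minus_one: "zpow p (int (Suc i) - 1) = z p ^ i"
  by simp

text \<open>
  The part of the terms of \<open>z\<^sub>p\<^sup>n \<odot> (x z\<^sub>l y)\<close> up to and including the letter in which
  \<open>z\<^sub>l\<close> ends up, if exactly \<open>i\<close> letters of \<open>z\<^sub>p\<^sup>n\<close> have been used by then.
\<close>

definition split_head :: "nat \<Rightarrow> nat \<Rightarrow> nat \<Rightarrow> h1 \<Rightarrow> h1" where
  "split_head p l i x =
     (z p ^ i \<odot> x) * z l + c * ((zpow p (int i - 1) \<odot> x) * z (p + l))"

lemma split_head_0: "x \<in> words \<Longrightarrow> split_head p l 0 x = x * z l"
  by (simp add: split_head_def)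

lemma split_head_Suc_one:
  "split_head p l (Suc i) 1 = z p * split_head p l i 1 + (if i = 0 then c * z (p + l) else 0)"
  by (cases i) (simp_all add: split_head_def distrib_left mult.assoc letter_central)

lemma split_head_Suc_mult:
  assumes "0 < p" "0 < a" "x \<in> words"
  shows "split_head p l (Suc i) (z a * x) =
    z p * split_head p l i (z a * x) + z a * split_head p l (Suc i) x
    + c * (z (p + a) * split_head p l i x)"
proof -
  have "z p ^ Suc i \<odot> (z a * x) =
      z p * (z p ^ i \<odot> (z a * x)) + z a * (z p ^ Suc i \<odot> x) + c * (z (p + a) * (z p ^ i \<odot> x))"
    using assms by (simp add: rec)
  moreover have "z p ^ i \<odot> (z a * x) =
      z p * (zpow p (int i - 1) \<odot> (z a * x)) + z a * (z p ^ i \<odot> x)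
      + c * (z (p + a) * (zpow p (int i - 1) \<odot> x))"
    using zpow_rec [OF assms, of i] by simp
  ultimately show ?thesis
    unfolding split_head_def zpow_Suc_minus_one
    by (simp add: distrib_left distrib_right mult.assoc letter_central del: power_Suc)
qed

text \<open>
  The terms on the left are sorted by the number \<open>i\<close> of letters of \<open>z\<^sub>p\<^sup>m\<close> used
  up to and including the place of \<open>z\<^sub>l\<close>; behind it the rest of the power meets \<open>y\<close>.
  The recursion peels off the first letter of \<open>x\<close> or of the power, and the heads on the right
  satisfy the same recursion.
\<close>

lemma power_split_at_letter:
  assumes "0 < p" "0 < l" and "x \<in> words" and "y \<in> words"
  shows "z p ^ m \<odot> (x * z l * y) = (\<Sum>i\<le>m. split_head p l i x * (z p ^ (m - i) \<odot> y))"
  using \<open>x \<in> words\<close>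
proof (induction x arbitrary: m rule: words_induct)
  case one
  show ?case
  proof (induction m)
    case 0
    then show ?case using \<open>y \<in> words\<close> by (simp add: split_head_0)
  next
    case (Suc m)
    have "(\<Sum>i\<le>Suc m. split_head p l i 1 * (z p ^ (Suc m - i) \<odot> y))
        = z l * (z p ^ Suc m \<odot> y) + z p * (\<Sum>i\<le>m. split_head p l i 1 * (z p ^ (m - i) \<odot> y))
          + (\<Sum>i\<le>m. if i = 0 then c * (z (p + l) * (z p ^ m \<odot> y)) else 0)"
      unfolding sum.atMost_Suc_shift sum_distrib_left add.assoc sum.distrib [symmetric]
      by (intro arg_cong2 [where f = "(+)"] sum.cong)
         (auto simp: split_head_0 split_head_Suc_one distrib_right mult.assoc)
    also have "\<dots> = z l * (z p ^ Suc m \<odot> y) + z p * (z p ^ m \<odot> (z l * y))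
        + c * (z (p + l) * (z p ^ m \<odot> y))"
      using Suc.IH by simp
    also have "\<dots> = z p ^ Suc m \<odot> (z l * y)"
      using assms by (simp add: rec)
    finally show ?case by simp
  qed
next
  case (mult a x)
  show ?case
  proof (induction m)
    case 0
    then show ?case using \<open>y \<in> words\<close> mult.hyps by (simp add: split_head_0)
  next
    case (Suc m)
    let ?S = "\<lambda>m x. \<Sum>i\<le>m. split_head p l i x * (z p ^ (m - i) \<odot> y)"
    have "?S (Suc m) (z a * x) = z a * (split_head p l 0 x * (z p ^ Suc m \<odot> y))
        + (\<Sum>i\<le>m. z p * (split_head p l i (z a * x) * (z p ^ (m - i) \<odot> y))
              + z a * (split_head p l (Suc i) x * (z p ^ (m - i) \<odot> y))
              + c * (z (p + a) * (split_head p l i x * (z p ^ (m - i) \<odot> y))))"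
      unfolding sum.atMost_Suc_shift using mult.hyps \<open>0 < p\<close>
      by (intro arg_cong2 [where f = "(+)"] sum.cong)
         (auto simp: split_head_0 split_head_Suc_mult distrib_right mult.assoc)
    also have "\<dots> = z p * ?S m (z a * x) + z a * ?S (Suc m) x + c * (z (p + a) * ?S m x)"
      unfolding sum.atMost_Suc_shift [of _ m]
      by (simp add: sum.distrib sum_distrib_left distrib_left add_ac)
    also have "\<dots> = z p * (z p ^ m \<odot> (z a * x * z l * y)) + z a * (z p ^ Suc m \<odot> (x * z l * y))
        + c * (z (p + a) * (z p ^ m \<odot> (x * z l * y)))"
      by (simp only: Suc.IH mult.IH)
    also have "\<dots> = z p ^ Suc m \<odot> (z a * x * z l * y)"
      using assms mult.hyps by (simp add: rec mult.assoc)
    finally show ?case by simp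
  qed
qed

text \<open>
  The sum collects the terms in which \<open>z\<^sub>k\<close> is inserted into \<open>z\<^sub>p\<^sup>n\<close>, stands
  directly behind it, or is merged with one of its letters. In all other terms \<open>z\<^sub>p\<^sup>n\<close> is split off in front of
  \<open>z\<^sub>k x \<odot> y\<close>; subtracting \<open>z\<^sub>k (x \<odot> y)\<close> there avoids counting twice the terms with
  an unmerged \<open>z\<^sub>k\<close> directly behind \<open>z\<^sub>p\<^sup>n\<close>. Stating the remainder as a difference lets one
  induction on \<open>n\<close> serve both for \<open>y = 1\<close>, where it vanishes, and for \<open>y\<close> with a first
  letter.
\<close>

lemma first_letter_through_power:
  assumes "0 < k" "0 < p" "x \<in> words" "y \<in> words"
  shows "(z k * x) \<odot> (z p ^ n * y) =
    (\<Sum>i\<le>n. (z p ^ i * z k + c * (zpow p (int i - 1) * z (p + k))) * (x \<odot> (z p ^ (n - i) * y)))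
    + z p ^ n * ((z k * x) \<odot> y - z k * (x \<odot> y))"
proof (induction n)
  case 0
  then show ?case by simp
next
  case (Suc n)
  define g where "g i = z p ^ i * z k + c * (zpow p (int i - 1) * z (p + k))" for i
  have g_0: "g 0 = z k"
    by (simp add: g_def)
  have g_Suc: "g (Suc i) = z p * g i + (if i = 0 then c * z (p + k) else 0)" for i
    by (cases i) (simp_all add: g_def distrib_left mult.assoc letter_central)
  let ?R = "z p ^ n * ((z k * x) \<odot> y - z k * (x \<odot> y))"
  have "(\<Sum>i\<le>Suc n. g i * (x \<odot> (z p ^ (Suc n - i) * y)))
      = z k * (x \<odot> (z p ^ Suc n * y)) + z p * (\<Sum>i\<le>n. g i * (x \<odot> (z p ^ (n - i) * y)))
        + (\<Sum>i\<le>n. if i = 0 then c * (z (p + k) * (x \<odot> (z p ^ n * y))) else 0)"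
    unfolding sum.atMost_Suc_shift sum_distrib_left add.assoc sum.distrib [symmetric]
    by (intro arg_cong2 [where f = "(+)"] sum.cong)
       (auto simp: g_0 g_Suc distrib_right mult.assoc)
  then have "(\<Sum>i\<le>Suc n. g i * (x \<odot> (z p ^ (Suc n - i) * y))) + z p * ?R
      = z k * (x \<odot> (z p ^ Suc n * y)) + z p * ((z k * x) \<odot> (z p ^ n * y))
        + c * (z (p + k) * (x \<odot> (z p ^ n * y)))"
    using Suc.IH by (simp add: g_def distrib_left add_ac)
  also have "\<dots> = (z k * x) \<odot> (z p ^ Suc n * y)"
    using assms by (simp add: rec mult.assoc add.commute)
  finally show ?case by (simp add: g_def mult.assoc)
qed

lemma first_letter_through_power_end:
  assumes "0 < k" "0 < p" "x \<in> words"
  shows "(z k * x) \<odot> z p ^ n =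
    (\<Sum>i\<le>n. (z p ^ i * z k + c * (zpow p (int i - 1) * z (p + k))) * (x \<odot> z p ^ (n - i)))"
  using first_letter_through_power [of k p x 1 n] assms by simp

lemma first_letter_through_power_letter:
  assumes "0 < k" "0 < p" "0 < l" "x \<in> words" "y \<in> words"
  shows "(z k * x) \<odot> (z p ^ n * (z l * y)) =
    (\<Sum>i\<le>n. (z p ^ i * z k + c * (zpow p (int i - 1) * z (p + k)))
        * (x \<odot> (z p ^ (n - i) * z l * y)))
    + z p ^ n * (z l * ((z k * x) \<odot> y) + c * (z (k + l) * (x \<odot> y)))"
  using first_letter_through_power [of k p x "z l * y" n] assms by (simp add: rec mult.assoc)

section \<open>The expansion\<close>

theorem weighted_expansion:
  assumes "0 < k" "0 < l1" "0 < l2" "0 < p"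
  shows "(z k * z p ^ m) \<odot> (z l1 * z p ^ n1 * z l2 * z p ^ n2) =
       (\<Sum>(i1, i2) \<in> {(i1, i2). i1 \<le> i2 \<and> i2 \<le> m}.
          z k * (z p ^ i1 * z l1 + c * (zpow p (int i1 - 1) * z (p + l1)))
            * ((z p ^ (i2 - i1) \<odot> z p ^ n1) * z l2
              + c * ((zpow p (int i2 - int i1 - 1) \<odot> z p ^ n1) * z (p + l2)))
            * (z p ^ (m - i2) \<odot> z p ^ n2))
     + (\<Sum>(i1, i2) \<in> {0..n1} \<times> {0..m}.
          z l1 * (z p ^ i1 * z k + c * (zpow p (int i1 - 1) * z (p + k)))
            * ((z p ^ i2 \<odot> z p ^ (n1 - i1)) * z l2
              + c * ((zpow p (int i2 - 1) \<odot> z p ^ (n1 - i1)) * z (p + l2)))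
            * (z p ^ (m - i2) \<odot> z p ^ n2))
     + c * (z l1 * z p ^ n1 * z (k + l2) * (z p ^ m \<odot> z p ^ n2))
     + (\<Sum>i = 0..n2.
          z l1 * z p ^ n1 * z l2 * (z p ^ i * z k + c * (zpow p (int i - 1) * z (p + k)))
            * (z p ^ m \<odot> z p ^ (n2 - i)))
     + c * (\<Sum>i = 0..m.
          z (k + l1)
            * ((z p ^ i \<odot> z p ^ n1) * z l2
              + c * ((zpow p (int i - 1) \<odot> z p ^ n1) * z (p + l2)))
            * (z p ^ (m - i) \<odot> z p ^ n2))"
    (is "_ = ?A + ?B + ?C + ?D + c * ?E")
proof -
  let ?v = "z p ^ n1 * z l2 * z p ^ n2"
  define head where
    "head q i = z p ^ i * z q + c * (zpow p (int i - 1) * z (p + q))" for q i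
  have head_eq: "head q i = split_head p q i 1" for q i
    by (simp add: head_def split_head_def)
  have split: "z p ^ j \<odot> (z p ^ n * z l2 * z p ^ n2) =
      (\<Sum>i\<le>j. split_head p l2 i (z p ^ n) * (z p ^ (j - i) \<odot> z p ^ n2))" for j n
    using assms by (intro power_split_at_letter) simp_all

  \<comment> \<open>The letter \<open>z\<^sub>k\<close> comes first: cut \<open>z\<^sub>p\<^sup>m\<close> at \<open>z\<^sub>l\<^sub>1\<close> and its remainder at \<open>z\<^sub>l\<^sub>2\<close>; the
    second cut is counted from the first one, hence the shift of the inner index.\<close>
  have first_k: "z k * (z p ^ m \<odot> (z l1 * ?v)) = ?A"
  proof -
    have "z p ^ m \<odot> (z l1 * ?v) = (\<Sum>i\<le>m. head l1 i * (z p ^ (m - i) \<odot> ?v))"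
      using power_split_at_letter [of p l1 1 ?v m] assms by (simp add: head_eq)
    then have "z k * (z p ^ m \<odot> (z l1 * ?v)) =
        (\<Sum>i\<le>m. \<Sum>j\<le>m - i. z k * head l1 i
          * split_head p l2 (i + j - i) (z p ^ n1) * (z p ^ (m - (i + j)) \<odot> z p ^ n2))"
      by (simp add: split [unfolded mult.assoc] sum_distrib_left mult.assoc)
    also have "\<dots> = (\<Sum>(i, j) \<in> {(i, j). i \<le> j \<and> j \<le> m}. z k * head l1 i
          * split_head p l2 (j - i) (z p ^ n1) * (z p ^ (m - j) \<odot> z p ^ n2))"
      by (rule sum_triangle_shift)
    also have "\<dots> = ?A"
      by (intro sum.cong) (auto simp: head_def split_head_def of_nat_diff)
    finally show ?thesis .
  qed

  \<comment> \<open>The letter \<open>z\<^sub>l\<^sub>1\<close> comes first: \<open>z\<^sub>k\<close> lands before \<open>z\<^sub>l\<^sub>2\<close>, on it, or behind it.\<close>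
  have first_l1: "z l1 * ((z k * z p ^ m) \<odot> ?v) = ?B + ?C + ?D"
  proof -
    have "(z k * z p ^ m) \<odot> ?v =
        (\<Sum>i\<le>n1. head k i * (z p ^ m \<odot> (z p ^ (n1 - i) * z l2 * z p ^ n2)))
        + z p ^ n1 * (z l2 * ((z k * z p ^ m) \<odot> z p ^ n2)
            + c * (z (k + l2) * (z p ^ m \<odot> z p ^ n2)))"
      using first_letter_through_power_letter [of k p l2 "z p ^ m" "z p ^ n2" n1] assms
      by (simp add: head_def mult.assoc)
    moreover have "(z k * z p ^ m) \<odot> z p ^ n2 = (\<Sum>i\<le>n2. head k i * (z p ^ m \<odot> z p ^ (n2 - i)))"
      using first_letter_through_power_end [of k p "z p ^ m" n2] assms by (simp add: head_def)
    ultimately have "z l1 * ((z k * z p ^ m) \<odot> ?v) =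
        (\<Sum>i\<le>n1. z l1 * (head k i * (z p ^ m \<odot> (z p ^ (n1 - i) * z l2 * z p ^ n2))))
        + z l1 * z p ^ n1 * (c * (z (k + l2) * (z p ^ m \<odot> z p ^ n2)))
        + (\<Sum>i\<le>n2. z l1 * z p ^ n1 * z l2 * head k i * (z p ^ m \<odot> z p ^ (n2 - i)))"
      by (simp add: sum_distrib_left distrib_left mult.assoc add_ac)
    moreover have "(\<Sum>i\<le>n1. z l1 * (head k i * (z p ^ m \<odot> (z p ^ (n1 - i) * z l2 * z p ^ n2)))) = ?B"
      unfolding sum.cartesian_product [symmetric] atMost_atLeast0 [symmetric] split sum_distrib_left
      by (intro sum.cong) (simp_all add: head_def split_head_def mult.assoc)
    moreover have "z l1 * z p ^ n1 * (c * (z (k + l2) * (z p ^ m \<odot> z p ^ n2))) = ?C"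
      using central [of "z l1 * z p ^ n1"] by (simp add: mult.assoc [symmetric])
    ultimately show ?thesis
      by (simp add: head_def atMost_atLeast0)
  qed

  have merged: "z (k + l1) * (z p ^ m \<odot> ?v) = ?E"
    unfolding split by (simp add: sum_distrib_left atMost_atLeast0 split_head_def mult.assoc)

  have "(z k * z p ^ m) \<odot> (z l1 * ?v) =
      z k * (z p ^ m \<odot> (z l1 * ?v)) + z l1 * ((z k * z p ^ m) \<odot> ?v)
      + c * (z (k + l1) * (z p ^ m \<odot> ?v))"
    using assms by (intro rec) simp_all
  then show ?thesis
    unfolding first_k first_l1 merged by (simp only: mult.assoc add.assoc)
qed

end

interpretation stuffle: weighted_stuffle stuffle 1
  by standard
     (auto simp: words_def stuffle_rec stuffle_word_Nil stuffle_def [of 0] bilinear_extension_def)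

interpretation stuffle_bar: weighted_stuffle stuffle_bar "- 1"
  by standard
     (auto simp: words_def stuffle_bar_rec stuffle_bar_word_Nil stuffle_bar_def [of 0]
        bilinear_extension_def)

theorem corollary1p4:
  fixes k l1 l2 p m n1 n2 :: nat
  assumes "0 < k" "0 < l1" "0 < l2" "0 < p"
  shows
    "(z k * z p ^ m) \<star> (z l1 * z p ^ n1 * z l2 * z p ^ n2) =
       (\<Sum>(i1, i2) \<in> {(i1, i2). i1 \<le> i2 \<and> i2 \<le> m}.
          z k * (z p ^ i1 * z l1 + zpow p (int i1 - 1) * z (p + l1))
            * ((z p ^ (i2 - i1) \<star> z p ^ n1) * z l2
              + (zpow p (int i2 - int i1 - 1) \<star> z p ^ n1) * z (p + l2))
            * (z p ^ (m - i2) \<star> z p ^ n2))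
     + (\<Sum>(i1, i2) \<in> {0..n1} \<times> {0..m}.
          z l1 * (z p ^ i1 * z k + zpow p (int i1 - 1) * z (p + k))
            * ((z p ^ i2 \<star> z p ^ (n1 - i1)) * z l2
              + (zpow p (int i2 - 1) \<star> z p ^ (n1 - i1)) * z (p + l2))
            * (z p ^ (m - i2) \<star> z p ^ n2))
     + z l1 * z p ^ n1 * z (k + l2) * (z p ^ m \<star> z p ^ n2)
     + (\<Sum>i = 0..n2.
          z l1 * z p ^ n1 * z l2 * (z p ^ i * z k + zpow p (int i - 1) * z (p + k))
            * (z p ^ m \<star> z p ^ (n2 - i)))
     + (\<Sum>i = 0..m.
          z (k + l1)
            * ((z p ^ i \<star> z p ^ n1) * z l2
              + (zpow p (int i - 1) \<star> z p ^ n1) * z (p + l2))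
            * (z p ^ (m - i) \<star> z p ^ n2))
     \<and>
     (z k * z p ^ m) \<star>\<^sub>- (z l1 * z p ^ n1 * z l2 * z p ^ n2) =
       (\<Sum>(i1, i2) \<in> {(i1, i2). i1 \<le> i2 \<and> i2 \<le> m}.
          z k * (z p ^ i1 * z l1 - zpow p (int i1 - 1) * z (p + l1))
            * ((z p ^ (i2 - i1) \<star>\<^sub>- z p ^ n1) * z l2
              - (zpow p (int i2 - int i1 - 1) \<star>\<^sub>- z p ^ n1) * z (p + l2))
            * (z p ^ (m - i2) \<star>\<^sub>- z p ^ n2))
     + (\<Sum>(i1, i2) \<in> {0..n1} \<times> {0..m}.
          z l1 * (z p ^ i1 * z k - zpow p (int i1 - 1) * z (p + k))
            * ((z p ^ i2 \<star>\<^sub>- z p ^ (n1 - i1)) * z l2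
              - (zpow p (int i2 - 1) \<star>\<^sub>- z p ^ (n1 - i1)) * z (p + l2))
            * (z p ^ (m - i2) \<star>\<^sub>- z p ^ n2))
     - z l1 * z p ^ n1 * z (k + l2) * (z p ^ m \<star>\<^sub>- z p ^ n2)
     + (\<Sum>i = 0..n2.
          z l1 * z p ^ n1 * z l2 * (z p ^ i * z k - zpow p (int i - 1) * z (p + k))
            * (z p ^ m \<star>\<^sub>- z p ^ (n2 - i)))
     - (\<Sum>i = 0..m.
          z (k + l1)
            * ((z p ^ i \<star>\<^sub>- z p ^ n1) * z l2
              - (zpow p (int i - 1) \<star>\<^sub>- z p ^ n1) * z (p + l2))
            * (z p ^ (m - i) \<star>\<^sub>- z p ^ n2))"
  using stuffle.weighted_expansion [OF assms, of m n1 n2]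
    stuffle_bar.weighted_expansion [OF assms, of m n1 n2]
  by (simp only: mult_1_left mult_minus1 add_uminus_conv_diff)

end
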